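(* Let $H\in\mathbb{R}^{n\times n}$ be symmetric positive definite, let $z\in\mathbb{R}^n$, and let $g:\mathbb{R}^n\to\mathbb{R}\cup\{+\infty\}$ be a quadratic-support (QS) function with parameters $A,b,d,B,\mathcal{K}$, i.e. $g(x)=\sup\{y^T(Bx+d)\mid y\in\mathbb{R}^\ell,\ Ay\succeq_{\mathcal{K}} b\}$. Then the following two problems form a (Fenchel) dual pair: $$\text{(P)}\quad \underset{x\in\mathbb{R}^n}{\text{minimize}}\ \ \tfrac12\|z-x\|_H^2+g(x),$$ $$\text{(D)}\quad \underset{y\in\mathbb{R}^\ell,\ Ay\succeq_{\mathcal{K}} b}{\text{minimize}}\ \ \tfrac12\, y^TBH^{-1}B^Ty-(d+Bz)^Ty.$$ Moreover, if strong duality holds, then corresponding primal-dual solutions $x$ of (P) and $y$ of (D) are related by $$Hx+B^Ty=Hz.$$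
   Context: Norm: $\|v\|_H^2:=v^THv$. Cones: $\mathcal{K}=\mathcal{K}_1\times\cdots\times\mathcal{K}_k$, where each $\mathcal{K}_i$ is either a nonnegative orthant $\mathbb{R}_+^{m_i}$ or a second-order cone $\mathbb{Q}^{m_i}=\{(\tau,w)\in\mathbb{R}\times\mathbb{R}^{m_i-1}\mid \|w\|_2\le\tau\}$. The notation $Ay\succeq_{\mathcal{K}} b$ means $Ay-b\in\mathcal{K}$. QS function: given $A\in\mathbb{R}^{m\times\ell}$ and $b\in\mathbb{R}^m$ (with $m=m_1+\cdots+m_k$), $B\in\mathbb{R}^{\ell\times n}$ and $d\in\mathbb{R}^\ell$, set $\mathcal{Y}=\{y\in\mathbb{R}^\ell\mid Ay\succeq_{\mathcal{K}} b\}$, which is assumed nonempty. The QS function with these parameters is $g(x)=\sup_{y\in\mathcal{Y}} y^T(Bx+d)$. Dual pair: let $h_1(x)=\tfrac12\|x-z\|_H^2$ for $x\in\mathbb{R}^n$ and $h_2(w)=\sup_{y\in\mathcal{Y}}y^T(w+d)$ for $w\in\mathbb{R}^\ell$, so that the objective of (P) is $h_1(x)+h_2(Bx)$. With $h^*(y)=\sup_x\{y^Tx-h(x)\}$ denoting the Fenchel conjugate, the Fenchel dual of $\inf_x\{h_1(x)+h_2(Bx)\}$ is $-\inf_y\{h_1^*(-B^Ty)+h_2^*(y)\}$. Saying that (P) and (D) are a dual pair means that the problem of minimizing $h_1^*(-B^Ty)+h_2^*(y)$ over $y\in\mathbb{R}^\ell$ is exactly (D): this function equals the objective of (D) when $Ay\succeq_{\mathcal{K}}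 b$ and $+\infty$ otherwise. Strong duality means that $\inf_x\{h_1(x)+h_2(Bx)\}=-\inf_y\{h_1^*(-B^Ty)+h_2^*(y)\}$ with the infima on both sides attained. *)

theory Defs
  imports "HOL-Analysis.Analysis"
begin

definition symmetric_pos_def :: "real^'n^'n \<Rightarrow> bool" where
  "symmetric_pos_def H \<longleftrightarrow>
     transpose H = H \<and> (\<forall>v. v \<noteq> 0 \<longrightarrow> 0 < v \<bullet> (H *v v))"

definition sq_norm_wrt :: "real^'n^'n \<Rightarrow> real^'n \<Rightarrow> real" where
  "sq_norm_wrt H v = v \<bullet> (H *v v)"

text \<open>
  The dimensions of the factors of a product cone vary from factor to factor, so a point of a
  factor is a list of coordinates; the product of the factors is formed by concatenation.
\<close>

datatype cone_factor = Orthant nat | Second_Order nat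

primrec factor_dim :: "cone_factor \<Rightarrow> nat" where
  "factor_dim (Orthant r) = r"
| "factor_dim (Second_Order r) = r"

primrec factor_set :: "cone_factor \<Rightarrow> real list set" where
  "factor_set (Orthant r) = {p. length p = r \<and> (\<forall>t\<in>set p. 0 \<le> t)}"
| "factor_set (Second_Order r) =
     {\<tau> # w | \<tau> w. length (\<tau> # w) = r \<and> sqrt (\<Sum>t\<leftarrow>w. t\<^sup>2) \<le> \<tau>}"

text \<open>The linear order on the index type fixes which coordinates form the consecutive blocks.\<close>

definition coords :: "real^'m::{finite,linorder} \<Rightarrow> real list" where
  "coords v = map (\<lambda>i. v $ i) (sorted_list_of_set UNIV)"

definition product_cone :: "cone_factor list \<Rightarrow> (real^'m::{finite,linorder}) set" where
  "product_cone Ks =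
     {v. \<exists>ps. list_all2 (\<lambda>p K. p \<in> factor_set K) ps Ks \<and> coords v = concat ps}"

definition qs_domain ::
  "real^'l^'m::{finite,linorder} \<Rightarrow> real^'m::{finite,linorder} \<Rightarrow> cone_factor list \<Rightarrow> (real^'l) set" where
  "qs_domain A b Ks = {y. A *v y - b \<in> product_cone Ks}"

definition support_fun :: "(real^'l) set \<Rightarrow> real^'l \<Rightarrow> real^'l \<Rightarrow> ereal" where
  "support_fun Y d w = (SUP y\<in>Y. ereal (y \<bullet> (w + d)))"

definition qs_function ::
  "real^'l^'m::{finite,linorder} \<Rightarrow> real^'m::{finite,linorder} \<Rightarrow> real^'l \<Rightarrow> real^'n^'l \<Rightarrow> cone_factor list
     \<Rightarrow> real^'n \<Rightarrow> ereal" where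
  "qs_function A b d B Ks x = (SUP y\<in>qs_domain A b Ks. ereal (y \<bullet> (B *v x + d)))"

definition fenchel_conjugate :: "('a::real_inner \<Rightarrow> ereal) \<Rightarrow> 'a \<Rightarrow> ereal" where
  "fenchel_conjugate h y = (SUP x. ereal (y \<bullet> x) - h x)"

definition fenchel_primal ::
  "(real^'n \<Rightarrow> ereal) \<Rightarrow> (real^'l \<Rightarrow> ereal) \<Rightarrow> real^'n^'l \<Rightarrow> real^'n \<Rightarrow> ereal" where
  "fenchel_primal h1 h2 B x = h1 x + h2 (B *v x)"

text \<open>The Fenchel dual is minus the infimum of the following function.\<close>

definition fenchel_dual ::
  "(real^'n \<Rightarrow> ereal) \<Rightarrow> (real^'l \<Rightarrow> ereal) \<Rightarrow> real^'n^'l \<Rightarrow> real^'l \<Rightarrow> ereal" where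
  "fenchel_dual h1 h2 B y =
     fenchel_conjugate h1 (- (transpose B *v y)) + fenchel_conjugate h2 y"

text \<open>
  Minimizing \<open>p\<close> over the whole space and minimizing \<open>q\<close> over \<open>Y\<close> are a Fenchel dual pair for
  the splitting given by \<open>h1\<close>, \<open>h2\<close> and \<open>B\<close>.
\<close>

definition fenchel_dual_pair ::
  "(real^'n \<Rightarrow> ereal) \<Rightarrow> (real^'l \<Rightarrow> ereal) \<Rightarrow> real^'n^'l
     \<Rightarrow> (real^'n \<Rightarrow> ereal) \<Rightarrow> (real^'l) set \<Rightarrow> (real^'l \<Rightarrow> real) \<Rightarrow> bool" where
  "fenchel_dual_pair h1 h2 B p Y q \<longleftrightarrow>
     (\<forall>x. p x = fenchel_primal h1 h2 B x) \<and>
     (\<forall>y. fenchel_dual h1 h2 B y = (if y \<in> Y then ereal (q y) else \<infinity>))"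

definition fenchel_strong_duality ::
  "(real^'n \<Rightarrow> ereal) \<Rightarrow> (real^'l \<Rightarrow> ereal) \<Rightarrow> real^'n^'l \<Rightarrow> bool" where
  "fenchel_strong_duality h1 h2 B \<longleftrightarrow>
     (INF x. fenchel_primal h1 h2 B x) = - (INF y. fenchel_dual h1 h2 B y) \<and>
     (\<exists>x0. fenchel_primal h1 h2 B x0 = (INF x. fenchel_primal h1 h2 B x)) \<and>
     (\<exists>y0. fenchel_dual h1 h2 B y0 = (INF y. fenchel_dual h1 h2 B y))"

end

theory Submission
  imports Defs
begin

text \<open>
  The conjugate of \<open>h1\<close> is computed by completing the square in the \<open>H\<close>-norm. The conjugate of the
  support function \<open>h2\<close> equals \<open>- y \<bullet> d\<close> on \<open>Y\<close>; off \<open>Y\<close> it is infinite, because \<open>Y\<close> is closed and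
  convex, so that a strictly separating direction makes the supremum diverge. At a primal-dual
  solution without duality gap, \<open>Y\<close>-feasibility of \<open>y\<close> bounds
  \<open>1/2 * sq_norm_wrt H (x - z + H\<^sup>-\<^sup>1 B\<^sup>T y)\<close> by the gap, so it vanishes.
\<close>

section \<open>Closedness and convexity of the product cone and of the feasible set\<close>

lemma second_order_lists_iff:
  "\<tau> # w \<in> factor_set (Second_Order r) \<longleftrightarrow>
     Suc (length w) = r \<and> L2_set (\<lambda>i. w ! i) {..<length w} \<le> \<tau>"
proof -
  have "(\<Sum>t\<leftarrow>w. t\<^sup>2) = (\<Sum>i<length w. (w ! i)\<^sup>2)"
    by (simp add: sum_list_sum_nth atLeast0LessThan)
  then show ?thesis
    by (auto simp: L2_set_def)
qed

text \<open>Factors are sets of lists, which carry no topology or linear structure. Pulling them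
  back along a list \<open>fs\<close> of linear functionals moves the question to a Euclidean space,
  where each factor is cut out by inequalities between continuous functions.\<close>

lemma closed_factor_preimage:
  fixes fs :: "('v::euclidean_space \<Rightarrow> real) list"
  assumes "\<forall>f\<in>set fs. linear f"
  shows "closed {v. map (\<lambda>f. f v) fs \<in> factor_set K}"
proof (cases K)
  case (Orthant r)
  have "closed {v. \<forall>f\<in>set fs. 0 \<le> f v}"
    using assms unfolding Collect_ball_eq
    by (intro closed_INT ballI closed_Collect_le continuous_on_const linear_continuous_on)
      (auto simp: linear_linear)
  then show ?thesis
    \<comment> \<open>If the lengths disagree, the preimage is empty.\<close>
    using Orthant by (cases "length fs = r") auto
next
  case (Second_Order r)
  show ?thesis
  proof (cases fs)
    case Nil
    then show ?thesis using Second_Order by simp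
  next
    case (Cons f gs)
    have lin: "continuous_on UNIV h" if "h \<in> set fs" for h
      using assms that by (auto intro: linear_continuous_on simp: linear_linear)
    have "continuous_on UNIV (\<lambda>v. L2_set (\<lambda>i. (gs ! i) v) {..<length gs})"
      unfolding L2_set_def using Cons by (intro continuous_intros lin) auto
    then have "closed {v. L2_set (\<lambda>i. (gs ! i) v) {..<length gs} \<le> f v}"
      using Cons by (intro closed_Collect_le) (auto intro: lin)
    moreover have "{v. map (\<lambda>f. f v) fs \<in> factor_set K} =
        {v. Suc (length gs) = r \<and> L2_set (\<lambda>i. (gs ! i) v) {..<length gs} \<le> f v}"
      unfolding Cons Second_Order list.map second_order_lists_iff
      by (simp cong: L2_set_cong_simp)
    ultimately show ?thesis
      by (cases "Suc (length gs) = r") auto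
  qed
qed

text \<open>A second-order factor pulls back to the set where a seminorm \<open>N\<close> is bounded
  by a linear functional, up to a condition on the length. Sublinearity of \<open>N\<close> follows
  from the triangle inequality for \<open>L2_set\<close>.\<close>

lemma convex_factor_preimage:
  fixes fs :: "('v::real_vector \<Rightarrow> real) list"
  assumes lin: "\<forall>f\<in>set fs. linear f"
  shows "convex {v. map (\<lambda>f. f v) fs \<in> factor_set K}"
proof (cases K)
  case (Orthant r)
  then show ?thesis
    using lin by (auto simp: convex_def linear_add linear_scale)
next
  case (Second_Order r)
  show ?thesis
  proof (cases fs)
    case Nil
    then show ?thesis using Second_Order by simp
  next
    case (Cons f gs)
    define N where "N v = L2_set (\<lambda>i. (gs ! i) v) {..<length gs}" for v
    have N_conv: "N (s *\<^sub>R v + t *\<^sub>R w) \<le> s * N v + t * N w" if "0 \<le> s" "0 \<le> t" for s t v w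
    proof -
      have "N (s *\<^sub>R v + t *\<^sub>R w) =
          L2_set (\<lambda>i. s * (gs ! i) v + t * (gs ! i) w) {..<length gs}"
        unfolding N_def using lin Cons
        by (intro L2_set_cong) (auto simp: linear_add linear_scale)
      also have "\<dots> \<le> L2_set (\<lambda>i. s * (gs ! i) v) {..<length gs} +
          L2_set (\<lambda>i. t * (gs ! i) w) {..<length gs}"
        by (rule L2_set_triangle_ineq)
      also have "\<dots> = s * N v + t * N w"
        using that by (simp add: N_def L2_set_right_distrib)
      finally show ?thesis .
    qed
    have iff: "map (\<lambda>f. f v) fs \<in> factor_set K \<longleftrightarrow> Suc (length gs) = r \<and> N v \<le> f v" for v
      unfolding Cons Second_Order list.map second_order_lists_iff N_def
      by (simp cong: L2_set_cong_simp)
    have f: "linear f"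
      using lin Cons by simp
    show ?thesis
      unfolding iff
    proof (rule convexI, safe)
      fix v w and s t :: real
      assume st: "0 \<le> s" "0 \<le> t" and le: "N v \<le> f v" "N w \<le> f w"
      have "N (s *\<^sub>R v + t *\<^sub>R w) \<le> s * N v + t * N w"
        using N_conv st by blast
      also have "\<dots> \<le> s * f v + t * f w"
        using st le by (intro add_mono mult_left_mono)
      also have "\<dots> = f (s *\<^sub>R v + t *\<^sub>R w)"
        using f by (simp add: linear_add linear_scale)
      finally show "N (s *\<^sub>R v + t *\<^sub>R w) \<le> f (s *\<^sub>R v + t *\<^sub>R w)" .
    qed
  qed
qed

lemma factor_set_length: "p \<in> factor_set K \<Longrightarrow> length p = factor_dim K"
  by (cases K) auto

text \<open>All members of a factor have the same length, so the first block can only be the prefix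
  of length \<open>factor_dim K\<close>. This removes the existential over the block decomposition
  one factor at a time.\<close>

lemma concat_in_factors_Cons:
  "(\<exists>ps. list_all2 (\<lambda>p K. p \<in> factor_set K) ps (K # Ks) \<and> xs = concat ps) \<longleftrightarrow>
     take (factor_dim K) xs \<in> factor_set K \<and>
     (\<exists>ps. list_all2 (\<lambda>p K. p \<in> factor_set K) ps Ks \<and> drop (factor_dim K) xs = concat ps)"
  (is "?L \<longleftrightarrow> ?R")
proof
  assume ?L
  then obtain p ps where "p \<in> factor_set K" "list_all2 (\<lambda>p K. p \<in> factor_set K) ps Ks"
    "xs = p @ concat ps"
    by (auto simp: list_all2_Cons2)
  then show ?R
    using factor_set_length[of p K] by auto
next
  assume ?R
  then obtain ps where "take (factor_dim K) xs \<in> factor_set K"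
    "list_all2 (\<lambda>p K. p \<in> factor_set K) ps Ks" "drop (factor_dim K) xs = concat ps"
    by blast
  then show ?L
    by (intro exI[of _ "take (factor_dim K) xs # ps"])
      (simp, metis append_take_drop_id)
qed

text \<open>Peeling off one factor writes the set as an intersection of a factor preimage with the
  same kind of set for the remaining functionals; hence the induction generalizes over
  \<open>fs\<close>.\<close>

lemma closed_convex_concat_preimage:
  fixes fs :: "('v::euclidean_space \<Rightarrow> real) list"
  assumes "\<forall>f\<in>set fs. linear f"
  defines "S \<equiv> \<lambda>fs Ks. {v::'v. \<exists>ps. list_all2 (\<lambda>p K. p \<in> factor_set K) ps Ks \<and>
     map (\<lambda>f. f v) fs = concat ps}"
  shows "closed (S fs Ks) \<and> convex (S fs Ks)"
  using assms(1)
proof (induction Ks arbitrary: fs)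
  case Nil
  then show ?case
    by (cases fs) (auto simp: S_def)
next
  case (Cons K Ks)
  define r where "r = factor_dim K"
  have "S fs (K # Ks) = {v. map (\<lambda>f. f v) (take r fs) \<in> factor_set K} \<inter> S (drop r fs) Ks"
    unfolding S_def concat_in_factors_Cons r_def by (auto simp: take_map drop_map)
  moreover have "\<forall>f\<in>set (take r fs). linear f" "\<forall>f\<in>set (drop r fs). linear f"
    using Cons.prems by (auto dest: in_set_takeD in_set_dropD)
  ultimately show ?case
    using Cons.IH[of "drop r fs"]
    by (simp add: closed_Int convex_Int closed_factor_preimage convex_factor_preimage)
qed

lemma closed_product_cone: "closed (product_cone Ks :: (real^'m::{finite,linorder}) set)"
  and convex_product_cone: "convex (product_cone Ks :: (real^'m::{finite,linorder}) set)"
proof -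
  let ?fs = "map (\<lambda>i v. v $ i) (sorted_list_of_set UNIV) ::
    (real^'m::{finite,linorder} \<Rightarrow> real) list"
  have "\<forall>f\<in>set ?fs. linear f"
    by (auto intro: linearI)
  from closed_convex_concat_preimage[OF this, of Ks]
  show "closed (product_cone Ks :: (real^'m::{finite,linorder}) set)"
    "convex (product_cone Ks :: (real^'m::{finite,linorder}) set)"
    by (simp_all add: product_cone_def coords_def comp_def)
qed

lemma closed_qs_domain: "closed (qs_domain A b Ks)"
proof -
  have "closed ((\<lambda>y. A *v y - b) -` product_cone Ks)"
    by (intro closed_vimage closed_product_cone continuous_intros)
  then show ?thesis
    by (simp add: qs_domain_def vimage_def)
qed

lemma convex_qs_domain: "convex (qs_domain A b Ks)"
proof -
  \<comment> \<open>Moving \<open>b\<close> to the cone leaves a linear preimage of a translated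
    convex set.\<close>
  have "qs_domain A b Ks = (*v) A -` ((+) b ` product_cone Ks)"
    by (auto simp: qs_domain_def image_iff algebra_simps) (metis add.commute diff_add_cancel)
  then show ?thesis
    by (simp add: convex_linear_vimage convex_translation convex_product_cone)
qed

section \<open>The conjugate of the support function\<close>

lemma fenchel_conjugate_support_fun:
  fixes Y :: "(real^'l) set"
  assumes "Y \<noteq> {}" "closed Y" "convex Y"
  shows "fenchel_conjugate (support_fun Y d) y = (if y \<in> Y then ereal (- (y \<bullet> d)) else \<infinity>)"
proof (cases "y \<in> Y")
  case True
  have "fenchel_conjugate (support_fun Y d) y = ereal (- (y \<bullet> d))"
    unfolding fenchel_conjugate_def
  proof (rule antisym)
    show "(SUP w. ereal (y \<bullet> w) - support_fun Y d w) \<le> ereal (- (y \<bullet> d))"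
    proof (rule SUP_least)
      fix w
      have "ereal (y \<bullet> (w + d)) \<le> support_fun Y d w"
        unfolding support_fun_def using True by (rule SUP_upper)
      then show "ereal (y \<bullet> w) - support_fun Y d w \<le> ereal (- (y \<bullet> d))"
        by (cases "support_fun Y d w") (auto simp: inner_add_right)
    qed
    \<comment> \<open>The bound is attained at \<open>- d\<close>, where every term of the supremum
      over the nonempty \<open>Y\<close> is zero.\<close>
    have "support_fun Y d (- d) = 0"
      using assms(1) by (simp add: support_fun_def zero_ereal_def)
    then show "ereal (- (y \<bullet> d)) \<le> (SUP w. ereal (y \<bullet> w) - support_fun Y d w)"
      by (intro SUP_upper2[of "- d"]) auto
  qed
  with True show ?thesis by simp
next
  case False
  obtain a c where a: "a \<bullet> y < c" "\<forall>x\<in>Y. c < a \<bullet> x"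
    using separating_hyperplane_closed_point[OF assms(3,2) False] by blast
  have bound: "ereal t \<le> fenchel_conjugate (support_fun Y d) y" for t
  proof -
    \<comment> \<open>The direction \<open>- a\<close> separates \<open>y\<close> from
      \<open>Y\<close>, and the summand \<open>- d\<close> in \<open>w\<close> cancels the shift in
      \<open>support_fun\<close>. The conjugate is then at least
      \<open>s * (c - a \<bullet> y) - y \<bullet> d\<close>, and \<open>s\<close> is scaled so that
      this is at least \<open>t\<close>.\<close>
    define s where "s = \<bar>t + y \<bullet> d\<bar> / (c - a \<bullet> y)"
    define w where "w = - (s *\<^sub>R a) - d"
    have s: "0 \<le> s" "s * (c - a \<bullet> y) = \<bar>t + y \<bullet> d\<bar>"
      using a(1) by (auto simp: s_def)
    have "support_fun Y d w \<le> ereal (- (s * c))"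
      unfolding support_fun_def w_def
    proof (rule SUP_least)
      fix x assume "x \<in> Y"
      then have "s * c \<le> s * (a \<bullet> x)"
        using a(2) s(1) by (intro mult_left_mono) auto
      then show "ereal (x \<bullet> (- (s *\<^sub>R a) - d + d)) \<le> ereal (- (s * c))"
        by (simp add: inner_commute)
    qed
    moreover have "y \<bullet> w + s * c = \<bar>t + y \<bullet> d\<bar> - y \<bullet> d"
      using s(2) by (simp add: w_def inner_diff_right inner_commute algebra_simps)
    ultimately have "ereal t \<le> ereal (y \<bullet> w) - support_fun Y d w"
      by (cases "support_fun Y d w") auto
    then show ?thesis
      unfolding fenchel_conjugate_def by (intro SUP_upper2[of w]) auto
  qed
  then have "fenchel_conjugate (support_fun Y d) y = \<infinity>"
    by (intro ereal_top)
  with False show ?thesis by simp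
qed

section \<open>The \<open>H\<close>-norm and the conjugate of the quadratic term\<close>

lemma symmetric_pos_def_mult_inv:
  fixes H :: "real^'n^'n"
  assumes "symmetric_pos_def H"
  shows "H *v (matrix_inv H *v u) = u"
proof -
  have "x = 0" if "H *v x = 0" for x
    using assms that unfolding symmetric_pos_def_def by (metis inner_zero_right less_irrefl)
  then have "invertible H"
    by (simp add: invertible_left_inverse matrix_left_invertible_ker)
  \<comment> \<open>\<open>matrix_inv\<close> is a choice of a two-sided inverse, so its property
    comes from existence.\<close>
  then have "H ** matrix_inv H = mat 1"
    unfolding invertible_def matrix_inv_def by (rule someI2_ex) blast
  then show ?thesis
    by (simp add: matrix_vector_mul_assoc)
qed

lemma symmetric_inner_mult_commute:
  fixes H :: "real^'n^'n"
  assumes "symmetric_pos_def H"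
  shows "x \<bullet> (H *v y) = y \<bullet> (H *v x)"
  using assms unfolding symmetric_pos_def_def
  by (metis dot_lmul_matrix inner_commute transpose_matrix_vector)

lemma sq_norm_wrt_nonneg: "symmetric_pos_def H \<Longrightarrow> 0 \<le> sq_norm_wrt H v"
  unfolding symmetric_pos_def_def sq_norm_wrt_def
  by (cases "v = 0") (auto simp: less_imp_le)

lemma sq_norm_wrt_eq_0: "symmetric_pos_def H \<Longrightarrow> sq_norm_wrt H v \<le> 0 \<Longrightarrow> v = 0"
  unfolding symmetric_pos_def_def sq_norm_wrt_def by fastforce

lemma sq_norm_wrt_minus: "sq_norm_wrt H (- v) = sq_norm_wrt H v"
  using matrix_vector_mult_diff_distrib[of H 0 v] by (simp add: sq_norm_wrt_def)

text \<open>By symmetry of \<open>H\<close>, both cross terms equal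
  \<open>u \<bullet> v\<close>.\<close>

lemma complete_square_wrt:
  assumes "symmetric_pos_def H"
  shows "sq_norm_wrt H (v - matrix_inv H *v u) =
    sq_norm_wrt H v - 2 * (u \<bullet> v) + u \<bullet> (matrix_inv H *v u)"
  using symmetric_inner_mult_commute[OF assms, of "matrix_inv H *v u" v]
  by (simp add: sq_norm_wrt_def matrix_vector_mult_diff_distrib inner_diff_left inner_diff_right
      symmetric_pos_def_mult_inv[OF assms] inner_commute)

lemma fenchel_conjugate_half_sq_norm:
  assumes "symmetric_pos_def H"
  shows "fenchel_conjugate (\<lambda>x. ereal (1/2 * sq_norm_wrt H (x - z))) u =
    ereal (u \<bullet> z + 1/2 * (u \<bullet> (matrix_inv H *v u)))"
  unfolding fenchel_conjugate_def
proof (rule antisym)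
  have eq: "u \<bullet> x - 1/2 * sq_norm_wrt H (x - z) =
      u \<bullet> z + 1/2 * (u \<bullet> (matrix_inv H *v u))
        - 1/2 * sq_norm_wrt H (x - z - matrix_inv H *v u)" for x
    unfolding complete_square_wrt[OF assms] by (simp add: inner_diff_right field_simps)
  show "(SUP x. ereal (u \<bullet> x) - ereal (1/2 * sq_norm_wrt H (x - z))) \<le>
      ereal (u \<bullet> z + 1/2 * (u \<bullet> (matrix_inv H *v u)))"
    using eq sq_norm_wrt_nonneg[OF assms] by (intro SUP_least) simp
  show "ereal (u \<bullet> z + 1/2 * (u \<bullet> (matrix_inv H *v u))) \<le>
      (SUP x. ereal (u \<bullet> x) - ereal (1/2 * sq_norm_wrt H (x - z)))"
    \<comment> \<open>This is the maximizer: the subtracted square in \<open>eq\<close> vanishes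
      there.\<close>
    using eq[of "z + matrix_inv H *v u"]
    by (intro SUP_upper2[of "z + matrix_inv H *v u"]) (auto simp: sq_norm_wrt_def)
qed

section \<open>The dual pair and the optimality relation\<close>

theorem proposition4p1:
  fixes H :: "real^'n^'n" and z :: "real^'n"
    and g :: "real^'n \<Rightarrow> ereal"
    and A :: "real^'l^'m::{finite,linorder}" and b :: "real^'m::{finite,linorder}"
    and d :: "real^'l" and B :: "real^'n^'l" and Ks :: "cone_factor list"
    and Y :: "(real^'l) set"
    and h1 :: "real^'n \<Rightarrow> ereal" and h2 :: "real^'l \<Rightarrow> ereal"
    and P :: "real^'n \<Rightarrow> ereal" and D :: "real^'l \<Rightarrow> real"
  defines "Y \<equiv> qs_domain A b Ks"
    and "h1 \<equiv> \<lambda>x. ereal (1/2 * sq_norm_wrt H (x - z))"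
    and "h2 \<equiv> support_fun Y d"
    and "P \<equiv> \<lambda>x. ereal (1/2 * sq_norm_wrt H (z - x)) + g x"
    and "D \<equiv> \<lambda>y. 1/2 * (y \<bullet> ((B ** matrix_inv H ** transpose B) *v y)) - (d + B *v z) \<bullet> y"
  assumes "symmetric_pos_def H"
    and "(\<Sum>K\<leftarrow>Ks. factor_dim K) = CARD('m)"
    and "Y \<noteq> {}"
    and "g = qs_function A b d B Ks"
  shows "fenchel_dual_pair h1 h2 B P Y D \<and>
    (fenchel_strong_duality h1 h2 B \<longrightarrow>
      (\<forall>x y. is_arg_min P (\<lambda>_. True) x \<longrightarrow> is_arg_min D (\<lambda>y. y \<in> Y) y \<longrightarrow>
        H *v x + transpose B *v y = H *v z))"
proof -
  note H = assms(6)
  define u where "u y = transpose B *v y" for y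
  have inner_B: "y \<bullet> (B *v x) = u y \<bullet> x" for x y
    by (simp add: u_def dot_lmul_matrix transpose_matrix_vector)
  have D_eq: "D y = 1/2 * (u y \<bullet> (matrix_inv H *v u y)) - d \<bullet> y - u y \<bullet> z" for y
    by (simp add: D_def inner_B inner_add_left inner_commute[of "B *v z"] u_def
        flip: matrix_vector_mul_assoc)
  have P_eq: "P x = fenchel_primal h1 h2 B x" for x
    using sq_norm_wrt_minus[of H "x - z"]
    by (simp add: P_def assms(9) fenchel_primal_def h1_def h2_def support_fun_def
        qs_function_def Y_def)
  have dual_eq: "fenchel_dual h1 h2 B y = (if y \<in> Y then ereal (D y) else \<infinity>)" for y
  proof -
    have "fenchel_conjugate h2 y = (if y \<in> Y then ereal (- (y \<bullet> d)) else \<infinity>)"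
      unfolding h2_def using assms(8)
      by (intro fenchel_conjugate_support_fun) (auto simp: Y_def closed_qs_domain convex_qs_domain)
    moreover have "matrix_inv H *v (- u y) = - (matrix_inv H *v u y)"
      using matrix_vector_mult_diff_distrib[of "matrix_inv H" 0 "u y"] by simp
    ultimately show ?thesis
      unfolding fenchel_dual_def h1_def fenchel_conjugate_half_sq_norm[OF H] u_def[symmetric]
      by (simp add: D_eq inner_commute)
  qed
  have "H *v x + transpose B *v y = H *v z"
    if sd: "fenchel_strong_duality h1 h2 B"
      and x: "is_arg_min P (\<lambda>_. True) x" and y: "is_arg_min D (\<lambda>y. y \<in> Y) y" for x y
  proof -
    have yY: "y \<in> Y"
      using y by (simp add: is_arg_min_def)
    have "P x = (INF x. fenchel_primal h1 h2 B x)"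
      using x unfolding P_eq[symmetric] is_arg_min_linorder
      by (intro antisym INF_greatest INF_lower) auto
    \<comment> \<open>Off \<open>Y\<close> the dual function is infinite, so minimizing
      \<open>D\<close> over \<open>Y\<close> yields the infimum over the whole space.\<close>
    moreover have "ereal (D y) = (INF y. fenchel_dual h1 h2 B y)"
      using y unfolding dual_eq is_arg_min_linorder
      by (intro antisym INF_greatest INF_lower2[of y]) auto
    ultimately have gap: "P x = ereal (- D y)"
      using sd by (simp add: fenchel_strong_duality_def flip: uminus_ereal.simps)
    have "ereal (y \<bullet> (B *v x + d)) \<le> h2 (B *v x)"
      unfolding h2_def support_fun_def using yY by (rule SUP_upper)
    then have "ereal (1/2 * sq_norm_wrt H (x - z) + y \<bullet> (B *v x + d)) \<le> P x"
      unfolding P_eq fenchel_primal_def h1_def plus_ereal.simps(1)[symmetric]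
      by (intro add_left_mono)
    then have "1/2 * sq_norm_wrt H (x - z) + y \<bullet> (B *v x + d) \<le> - D y"
      by (simp add: gap)
    \<comment> \<open>Completing the square at \<open>z - x\<close> gives exactly twice the sum of
      \<open>D y\<close> and the lower bound for \<open>P x\<close>. The zero gap makes that sum
      nonpositive, so the squared norm vanishes.\<close>
    moreover have "sq_norm_wrt H (z - x - matrix_inv H *v u y) =
        2 * (1/2 * sq_norm_wrt H (x - z) + y \<bullet> (B *v x + d) + D y)"
      using sq_norm_wrt_minus[of H "x - z"]
      unfolding complete_square_wrt[OF H]
      by (simp add: D_eq inner_add_right inner_B inner_diff_right inner_commute[of y d])
    ultimately have "(z - x) - matrix_inv H *v u y = 0"
      by (intro sq_norm_wrt_eq_0[OF H]) simp
    \<comment> \<open>Multiplying by \<open>H\<close> cancels the inverse and leaves the transpose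
      of \<open>B\<close> applied to \<open>y\<close>.\<close>
    then have "H *v (z - x) = H *v (matrix_inv H *v u y)"
      by simp
    then show ?thesis
      by (simp add: symmetric_pos_def_mult_inv[OF H] matrix_vector_mult_diff_distrib u_def
          algebra_simps)
  qed
  then show ?thesis
    using P_eq dual_eq by (simp add: fenchel_dual_pair_def)
qed

end
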